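(* Let $\Bbbk$ be an algebraically closed field of characteristic $p>0$ and let $q\in\Bbbk^*$ be a root of $1$ of order $p$. Let $D$ be the algebra defined in the context, let $\omega$ be an orbit of $\langle\alpha\rangle$ on $\mathrm{Max}(R)$, and let $V=\bigoplus_{\mathfrak m\in\omega}V_{\mathfrak m}$ be a finite dimensional $D$ weight module with support contained in $\omega$. Then $\dim V_{\mathfrak m}=\dim V_{\mathfrak n}$ for any $\mathfrak m,\mathfrak n\in\omega$.
   Context: Let $R=\Bbbk[\tau,\sigma,\sigma^{-1}]$ be the localization of the polynomial algebra $\Bbbk[\tau,\sigma]$ at the powers of $\sigma$, and let $\alpha:R\to R$ be the $\Bbbk$-algebra automorphism with $\alpha(\tau)=\tau-1$, $\alpha(\sigma)=\sigma/q$. $D$ is the $\Bbbk$-algebra generated over $R$ by $X,Y,Y_1$ subject to the relations $$YX=\tau,\quad XY=\alpha(\tau)=\tau-1,\quad Y_1X=q\sigma-1,\quad XY_1=\alpha(q\sigma-1)=\sigma-1,\quad Y_1(\tau-1)=Y(\sigma-1),$$ $$Xr=\alpha(r)X,\quad Yr=\alpha^{-1}(r)Y,\quad Y_1r=\alpha^{-1}(r)Y_1\qquad (r\in R).$$ For a $D$-module $M$ and a maximal ideal $\mathfrak m$ of $R$ put $M_{\mathfrak m}=\{v\in M\mid\mathfrak mv=0\}$. $M$ is a weight module if $M=\sum_{\mathfrak m\in\mathrm{Max}(R)}M_{\mathfrak m}$; its support is the set of $\mathfrak m$ with $M_{\mathfrak m}\ne0$. The cyclic group $\langle\alpha\rangle$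 acts on $\mathrm{Max}(R)$.
   Formalization: In characteristic p no q has multiplicative order exactly p, since x^p−1=(x−1)^p; "root of 1 of order p" is therefore read as q^p=1, which forces q=1. *)

theory Defs
  imports
    "HOL-Library.Poly_Mapping"
    "HOL-Library.Product_Plus"
    "HOL-Computational_Algebra.Polynomial"
    "HOL-Algebra.QuotRing"
    "HOL-Algebra.Algebraic_Closure_Type"
begin

text \<open>
  \<open>\<Bbbk>[\<tau>, \<sigma>, \<sigma>\<^sup>-\<^sup>1]\<close> as the algebra with \<open>\<Bbbk>\<close>-basis the monomials \<open>\<tau>\<^sup>i \<sigma>\<^sup>j\<close>
  (\<open>i\<close> natural, \<open>j\<close> an integer), the exponent pair \<open>(i, j)\<close> being the index of the monomial.
\<close>

type_synonym 'k laurent = "(nat \<times> int) \<Rightarrow>\<^sub>0 'k"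

definition const :: "'k \<Rightarrow> 'k::field laurent"
  where "const c = Poly_Mapping.single 0 c"

definition tau :: "'k::field laurent"
  where "tau = Poly_Mapping.single (1, 0) 1"

definition sigma :: "'k::field laurent"
  where "sigma = Poly_Mapping.single (0, 1) 1"

text \<open>The substitution \<open>\<tau> \<mapsto> \<tau> + a\<close>, \<open>\<sigma> \<mapsto> c \<sigma>\<close>.\<close>

definition subst :: "'k::field \<Rightarrow> 'k \<Rightarrow> 'k laurent \<Rightarrow> 'k laurent"
  where "subst a c f = (\<Sum>(i, j) \<in> Poly_Mapping.keys f.
    const (Poly_Mapping.lookup f (i, j)) * (tau + const a) ^ i
      * Poly_Mapping.single (0, j) (c powi j))"

definition alpha :: "'k::field \<Rightarrow> 'k laurent \<Rightarrow> 'k laurent"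
  where "alpha q = subst (- 1) (1 / q)"

lemma const_simps [simp]:
  "const 0 = 0" "const 1 = 1" "const (x + y) = const x + const y"
  "const (x * y) = const x * const y" "const (- x) = - const x"
  by (simp_all add: const_def mult_single single_add single_uminus)

lemma subst_superset:
  assumes "finite A" "Poly_Mapping.keys f \<subseteq> A"
  shows "subst a c f = (\<Sum>(i, j) \<in> A.
    const (Poly_Mapping.lookup f (i, j)) * (tau + const a) ^ i
      * Poly_Mapping.single (0, j) (c powi j))"
  unfolding subst_def
  by (rule sum.mono_neutral_left) (use assms in \<open>auto simp: in_keys_iff\<close>)

lemma subst_add: "subst a c (f + g) = subst a c f + subst a c g"
proof -
  let ?A = "Poly_Mapping.keys f \<union> Poly_Mapping.keys g"
  have "Poly_Mapping.keys (f + g) \<subseteq> ?A"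
    by (rule Poly_Mapping.keys_add)
  then show ?thesis
    by (simp add: subst_superset[of ?A] lookup_add sum.distrib[symmetric] case_prod_unfold
        distrib_right)
qed

lemma subst_single:
  "subst a c (Poly_Mapping.single (i, j) x)
    = const x * (tau + const a) ^ i * Poly_Mapping.single (0, j) (c powi j)"
  by (subst subst_superset[of "{(i, j)}"]) auto

lemma subst_const: "subst a c (const x) = const x"
  using subst_single[of a c 0 0 x] by (simp add: const_def flip: zero_prod_def)

lemma poly_mapping_add_induct [case_names zero single add]:
  assumes "P 0" "\<And>k x. P (Poly_Mapping.single k x)" "\<And>f g. P f \<Longrightarrow> P g \<Longrightarrow> P (f + g)"
  shows "P (f :: 'a \<Rightarrow>\<^sub>0 'b::comm_monoid_add)"
proof (induction f rule: update_induct)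
  case const
  then show ?case by (rule assms(1))
next
  case (update f k x)
  have "Poly_Mapping.update k x f = f + Poly_Mapping.single k x"
    using update.hyps(1)
    by (intro poly_mapping_eqI) (auto simp: lookup_update lookup_add lookup_single in_keys_iff when_def)
  then show ?case using assms update.IH by simp
qed

lemma subst_mult:
  assumes "c \<noteq> 0"
  shows "subst a c (f * g) = subst a c f * subst a c g"
proof (induction f rule: poly_mapping_add_induct)
  case (single k x)
  show ?case
  proof (induction g rule: poly_mapping_add_induct)
    case (single l y)
    obtain i j i' j' where [simp]: "k = (i, j)" "l = (i', j')" by fastforce
    have "Poly_Mapping.single (0::nat, j + j') (c powi (j + j'))
        = Poly_Mapping.single (0, j) (c powi j) * Poly_Mapping.single (0, j') (c powi j')"
      using assms by (simp add: mult_single power_int_add)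
    then show ?case
      by (simp add: mult_single subst_single power_add algebra_simps)
  qed (simp_all add: subst_add distrib_left, simp add: subst_def)
qed (simp_all add: subst_add distrib_right, simp add: subst_def)

lemma alpha_add: "alpha q (f + g) = alpha q f + alpha q g"
  and alpha_mult: "q \<noteq> 0 \<Longrightarrow> alpha q (f * g) = alpha q f * alpha q g"
  and alpha_const: "alpha q (const x) = const x"
  by (simp_all add: alpha_def subst_add subst_mult subst_const)

lemma subst_tau: "subst a c tau = tau + const a"
  by (simp add: tau_def subst_single flip: zero_prod_def)

lemma subst_sigma: "subst a c sigma = const c * sigma"
  by (simp add: sigma_def subst_single const_def mult_single)

lemma alpha_tau: "alpha q tau = tau - 1"
  by (simp add: alpha_def subst_tau)

lemma alpha_sigma: "alpha q sigma = const (1 / q) * sigma"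
  unfolding alpha_def by (rule subst_sigma)

lemma subst_zero [simp]: "subst a c 0 = 0"
  by (simp add: subst_def)

lemma subst_one [simp]: "subst a c 1 = 1"
  using subst_const[of a c 1] by simp

lemma subst_power: "c \<noteq> 0 \<Longrightarrow> subst a c (f ^ n) = subst a c f ^ n"
  by (induction n) (simp_all add: subst_mult)

lemma tau_power: "tau ^ i = Poly_Mapping.single (i, 0) 1"
  by (induction i) (simp_all add: tau_def mult_single flip: zero_prod_def)

lemma subst_inverse:
  assumes "c \<noteq> 0"
  shows "subst (- a) (1 / c) (subst a c f) = f"
proof (induction f rule: poly_mapping_add_induct)
  case (single k x)
  obtain i j where [simp]: "k = (i, j)" by fastforce
  have "subst (- a) (1 / c) (Poly_Mapping.single (0, j) (c powi j))
      = Poly_Mapping.single (0, j) 1"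
    using assms by (simp add: subst_single const_def mult_single power_int_divide_distrib)
  moreover have "subst (- a) (1 / c) (tau + const a) = tau"
    by (simp add: subst_add subst_tau subst_const)
  ultimately show ?case
    using assms
    by (simp add: subst_single subst_mult subst_power subst_const)
      (simp add: tau_power const_def mult_single)
qed (simp_all add: subst_add)

lemma bij_alpha:
  assumes "q \<noteq> 0"
  shows "bij (alpha q)"
proof (rule o_bij[of "subst 1 q"])
  show "subst 1 q \<circ> alpha q = id"
    using subst_inverse[of "1 / q" "- 1"] assms by (auto simp: alpha_def fun_eq_iff)
  show "alpha q \<circ> subst 1 q = id"
    using subst_inverse[of q 1] assms by (auto simp: alpha_def fun_eq_iff)
qed

text \<open>
  Words over an alphabet form the free monoid, written additively so that finitely supported
  functions on words, with their convolution product, are the free \<open>\<Bbbk>\<close>-algebra on the alphabet.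
\<close>

datatype 'g word = Word "'g list"

instantiation word :: (type) monoid_add
begin

definition zero_word :: "'g word"
  where "zero_word = Word []"

fun plus_word :: "'g word \<Rightarrow> 'g word \<Rightarrow> 'g word"
  where "plus_word (Word u) (Word v) = Word (u @ v)"

instance
proof
  show "(u + v) + w = u + (v + w)" for u v w :: "'g word"
    by (cases u; cases v; cases w) simp
  show "0 + u = u" "u + 0 = u" for u :: "'g word"
    by (cases u; simp add: zero_word_def)+
qed

end

datatype 'r gen = Coef 'r | GX | GY | GY1

type_synonym 'k free_alg = "'k laurent gen word \<Rightarrow>\<^sub>0 'k"

definition scal :: "'k \<Rightarrow> 'k::field free_alg"
  where "scal c = Poly_Mapping.single 0 c"

definition gen :: "'k laurent gen \<Rightarrow> 'k::field free_alg"
  where "gen g = Poly_Mapping.single (Word [g]) 1"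

text \<open>
  All elements of \<open>R\<close> are taken as generators; the first three families of relations make
  \<open>Coef\<close> a homomorphism of \<open>\<Bbbk>\<close>-algebras. A relation \<open>u = v\<close> is encoded by \<open>u - v\<close>.
\<close>

inductive_set relations :: "'k::field \<Rightarrow> 'k free_alg set" for q :: 'k
  where
    "gen (Coef (r + s)) - (gen (Coef r) + gen (Coef s)) \<in> relations q"
  | "gen (Coef (r * s)) - gen (Coef r) * gen (Coef s) \<in> relations q"
  | "gen (Coef (const c)) - scal c \<in> relations q"
  | "gen GY * gen GX - gen (Coef tau) \<in> relations q"
  | "gen GX * gen GY - gen (Coef (alpha q tau)) \<in> relations q"
  | "gen GY1 * gen GX - gen (Coef (const q * sigma - 1)) \<in> relations q"
  | "gen GX * gen GY1 - gen (Coef (alpha q (const q * sigma - 1))) \<in> relations q"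
  | "gen GY1 * gen (Coef (tau - 1)) - gen GY * gen (Coef (sigma - 1)) \<in> relations q"
  | "gen GX * gen (Coef r) - gen (Coef (alpha q r)) * gen GX \<in> relations q"
  | "gen GY * gen (Coef r) - gen (Coef (inv_into UNIV (alpha q) r)) * gen GY \<in> relations q"
  | "gen GY1 * gen (Coef r) - gen (Coef (inv_into UNIV (alpha q) r)) * gen GY1 \<in> relations q"

definition rel_ideal :: "'k::field \<Rightarrow> 'k free_alg set"
  where "rel_ideal q = Idl\<^bsub>ring_of_type_algebra\<^esub> (relations q)"

definition D :: "'k::field \<Rightarrow> 'k free_alg set ring"
  where "D q = ring_of_type_algebra Quot rel_ideal q"

definition D_class :: "'k::field \<Rightarrow> 'k free_alg \<Rightarrow> 'k free_alg set"
  where "D_class q x = rel_ideal q +>\<^bsub>ring_of_type_algebra\<^esub> x"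

lemma ring_of_type: "ring (ring_of_type_algebra :: 'a::ring_1 ring)"
proof -
  have "\<exists>y. y + x = 0 \<and> x + y = 0" for x :: 'a
    by (rule exI[of _ "- x"]) simp
  then show ?thesis
    unfolding ring_of_type_algebra_def
    by unfold_locales (auto simp: algebra_simps Units_def)
qed

lemma ideal_rel_ideal: "ideal (rel_ideal q) ring_of_type_algebra"
  unfolding rel_ideal_def
  by (rule ring.genideal_ideal[OF ring_of_type]) (simp add: ring_of_type_algebra_def)

lemma ring_D: "ring (D q)"
  unfolding D_def by (rule ideal.quotient_is_ring[OF ideal_rel_ideal])

text \<open>The locale \<open>module\<close> of HOL-Algebra requires a commutative ring of scalars.\<close>

locale left_module = ring A for A :: "('a, 'm) ring_scheme" (structure) +
  fixes act :: "'a \<Rightarrow> 'v::ab_group_add \<Rightarrow> 'v"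
  assumes act_add_right: "a \<in> carrier A \<Longrightarrow> act a (v + w) = act a v + act a w"
    and act_add_left: "\<lbrakk>a \<in> carrier A; b \<in> carrier A\<rbrakk> \<Longrightarrow> act (a \<oplus> b) v = act a v + act b v"
    and act_mult: "\<lbrakk>a \<in> carrier A; b \<in> carrier A\<rbrakk> \<Longrightarrow> act (a \<otimes> b) v = act a (act b v)"
    and act_one: "act \<one> v = v"

definition Max_R :: "'k::field laurent set set"
  where "Max_R = {\<mm>. maximalideal \<mm> ring_of_type_algebra}"

definition alpha_orbit :: "'k::field \<Rightarrow> 'k laurent set \<Rightarrow> 'k laurent set set"
  where "alpha_orbit q \<mm> =
    {(alpha q ^^ n) ` \<mm> |n. True} \<union> {(inv_into UNIV (alpha q) ^^ n) ` \<mm> |n. True}"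

context
  fixes q :: "'k::field"
    and act :: "'k free_alg set \<Rightarrow> 'v::ab_group_add \<Rightarrow> 'v"
begin

definition scale :: "'k \<Rightarrow> 'v \<Rightarrow> 'v"
  where "scale c = act (D_class q (scal c))"

definition weight_space :: "'k laurent set \<Rightarrow> 'v set"
  where "weight_space \<mm> = {v. \<forall>r\<in>\<mm>. act (D_class q (gen (Coef r))) v = 0}"

definition weight_module :: bool
  where "weight_module \<longleftrightarrow>
    left_module (D q) act \<and>
    (\<forall>v. \<exists>F f. finite F \<and> F \<subseteq> Max_R \<and> (\<forall>\<mm>\<in>F. f \<mm> \<in> weight_space \<mm>) \<and> v = (\<Sum>\<mm>\<in>F. f \<mm>))"

definition weight_support :: "'k laurent set set"
  where "weight_support = {\<mm> \<in> Max_R. weight_space \<mm> \<noteq> {0}}"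

definition finite_dim :: bool
  where "finite_dim \<longleftrightarrow> (\<exists>B. finite B \<and> module.span scale B = UNIV)"

end

end

theory Submission
  imports Defs
begin

text \<open>
  If \<open>\<tau> \<notin> \<mm>\<close>, then \<open>\<tau>\<close> acts invertibly on \<open>V\<^sub>\<mm>\<close>, so by \<open>YX = \<tau>\<close> and \<open>XY = \<alpha>(\<tau>)\<close> the generator \<open>X\<close> maps
  \<open>V\<^sub>\<mm>\<close> isomorphically onto \<open>V\<^bsub>\<alpha>(\<mm>)\<^esub>\<close>. Since \<open>\<alpha>\<^sup>p = 1\<close>, the orbit is a cycle
  \<open>\<mm>, \<alpha>(\<mm>), \<dots>, \<alpha>\<^sup>p(\<mm>) = \<mm>\<close>, and at most one of its \<open>p\<close> arrows starts at an ideal containing \<open>\<tau>\<close>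
  because the elements \<open>\<tau>, \<tau> + 1, \<dots>, \<tau> + p - 1\<close> differ by units. The dimension does not change along
  the remaining arrows, and these already connect all members of the cycle.
\<close>

section \<open>Linear algebra and maximal ideals\<close>

lemma (in vector_space) dim_image_eq_linear:
  assumes f: "Vector_Spaces.linear scale scale f" and S: "subspace S" and inj: "inj_on f S"
  shows "dim (f ` S) = dim S"
proof -
  interpret f: Vector_Spaces.linear scale scale f by fact
  obtain B where B: "B \<subseteq> S" "independent B" "S \<subseteq> span B" "card B = dim S"
    by (rule basis_exists)
  then have "span B = S"
    using S by (simp add: span_subspace)
  then have "independent (f ` B)"
    using B inj by (simp add: f.independent_injective_image)
  moreover have "f ` S \<subseteq> span (f ` B)"
    using B f.span_image by fastforce
  moreover have "card (f ` B) = dim S"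
    using B inj by (metis card_image inj_on_subset)
  ultimately show ?thesis
    using B by (metis dim_unique image_mono)
qed

text \<open>The ideal generated by \<open>I\<close> and \<open>x\<close> exceeds \<open>I\<close>,
  hence contains 1; the coefficient of \<open>x\<close> in such an expression of 1 inverts
  \<open>x\<close> modulo \<open>I\<close>.\<close>

lemma maximalideal_unit_mod:
  fixes I :: "'a::comm_ring_1 set"
  assumes I: "maximalideal I ring_of_type_algebra" and x: "x \<notin> I"
  obtains s where "s * x - 1 \<in> I"
proof -
  let ?R = "ring_of_type_algebra :: 'a ring"
  interpret cring ?R by (rule cring_from_type_algebra)
  interpret I: maximalideal I ?R by fact
  let ?J = "I <+>\<^bsub>?R\<^esub> PIdl\<^bsub>?R\<^esub> x"
  have J: "?J = {a + s * x | a s. a \<in> I}"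
    by (auto simp: set_add_def' cgenideal_def ring_of_type_algebra_def)
  have zero: "0 \<in> I"
    using I.zero_closed by (simp add: ring_of_type_algebra_def)
  have "ideal ?J ?R"
    by (intro add_ideals I.ideal_axioms cgenideal_ideal) (simp add: ring_of_type_algebra_def)
  moreover have "I \<subseteq> ?J"
    unfolding J by (force intro: exI[of _ 0])
  moreover have "x \<in> ?J"
    unfolding J using zero by (metis (mono_tags, lifting) CollectI add_0 mult_1)
  ultimately have "?J = UNIV"
    using I.I_maximal[of ?J] x by (auto simp: ring_of_type_algebra_def)
  then obtain a s where a: "a \<in> I" "1 = a + s * x"
    unfolding J by blast
  have "- a \<in> I"
    using I.I_l_closed[of a "- 1"] a by (simp add: ring_of_type_algebra_def)
  moreover have "- a = s * x - (a + s * x)"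
    by simp
  ultimately have "s * x - 1 \<in> I"
    using a by metis
  then show ?thesis by (rule that)
qed

text \<open>The difference lies in \<open>I\<close> again, and a proper ideal contains no
  unit.\<close>

lemma maximalideal_diff_not_unit:
  fixes I :: "'a::comm_ring_1 set"
  assumes I: "maximalideal I ring_of_type_algebra" and "x \<in> I" "y \<in> I"
  shows "c * (x - y) \<noteq> 1"
proof
  assume eq: "c * (x - y) = 1"
  let ?R = "ring_of_type_algebra :: 'a ring"
  interpret cring ?R by (rule cring_from_type_algebra)
  interpret I: maximalideal I ?R by fact
  have mult: "a * b \<in> I" if "b \<in> I" for a b
    using I.I_l_closed[of b a] that by (simp add: ring_of_type_algebra_def)
  have "a + b \<in> I" if "a \<in> I" "b \<in> I" for a b
    using I.a_closed[of a b] that by (simp add: ring_of_type_algebra_def)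
  from mult[OF this[OF \<open>x \<in> I\<close> mult[OF \<open>y \<in> I\<close>, of "- 1"]], of c] eq have "1 \<in> I"
    by simp
  then have "a \<in> I" for a
    using mult[of 1 a] by simp
  then show False
    using I.I_notcarr by (auto simp: ring_of_type_algebra_def)
qed

section \<open>Powers of the automorphism \<open>alpha q\<close>\<close>

lemma subst_subst:
  assumes "c \<noteq> 0" "d \<noteq> 0"
  shows "subst a c (subst b d f) = subst (a + b) (c * d) f"
proof (induction f rule: poly_mapping_add_induct)
  case (single k x)
  obtain i j where [simp]: "k = (i, j)" by fastforce
  have "subst a c (Poly_Mapping.single (0, j) (d powi j))
      = Poly_Mapping.single (0, j) ((c * d) powi j)"
    using assms
    by (simp add: subst_single const_def mult_single power_int_mult_distrib mult.commute)
  moreover have "subst a c (tau + const b) = tau + const (a + b)"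
    by (simp add: subst_add subst_tau subst_const add.assoc)
  ultimately show ?case
    using assms
    by (simp add: subst_single[of b] subst_single[of "a + b"] subst_mult subst_power subst_const
        del: const_simps)
qed (simp_all add: subst_add)

lemma subst_0_1 [simp]: "subst 0 1 f = f"
  \<comment> \<open>The identity substitution is written as a shift of \<open>tau\<close> by -1
    composed with its inverse.\<close>
  using subst_subst[of 1 1 1 "- 1" f] subst_inverse[of 1 "- 1" f] by simp

lemma alpha_funpow:
  assumes "q \<noteq> 0"
  shows "(alpha q ^^ n) f = subst (- of_nat n) (1 / q ^ n) f"
  using assms by (induction n) (simp_all add: alpha_def subst_subst add.commute)

lemma alpha_funpow_mult:
  "q \<noteq> 0 \<Longrightarrow> (alpha q ^^ n) (f * g) = (alpha q ^^ n) f * (alpha q ^^ n) g"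
  by (simp add: alpha_funpow subst_mult)

lemma alpha_diff_one: "alpha q (f - 1) = alpha q f - 1"
  using alpha_add[of q "f - 1" 1] alpha_const[of q 1] by (simp add: algebra_simps)

text \<open>This pulls conditions along the orbit back to one ideal: \<open>tau\<close> lies in the
  image of \<open>J\<close> under the \<open>n\<close>-th power iff
  \<open>tau + const (of_nat n)\<close> lies in \<open>J\<close>.\<close>

lemma alpha_funpow_tau_shift:
  assumes "q \<noteq> 0"
  shows "(alpha q ^^ n) (tau + const (of_nat n)) = tau"
  using assms by (simp add: alpha_funpow subst_add subst_tau subst_const algebra_simps)

text \<open>The accumulated shift of \<open>tau\<close> vanishes in the characteristic, and the
  accumulated factor of \<open>sigma\<close> is 1.\<close>

lemma alpha_funpow_period:
  assumes "q \<noteq> 0" "q ^ CHAR('k) = 1"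
  shows "alpha (q :: 'k::field) ^^ CHAR('k) = id"
  using assms by (simp add: fun_eq_iff alpha_funpow)

lemma inv_alpha_alpha: "q \<noteq> 0 \<Longrightarrow> inv_into UNIV (alpha q) (alpha q r) = r"
  by (simp add: bij_alpha bij_is_inj)

text \<open>Periodicity turns the backward half of \<open>alpha_orbit\<close> into forward powers,
  so natural exponents suffice.\<close>

lemma inv_funpow_eq_funpow:
  assumes "f ^^ p = id" "p > 0"
  shows "inv_into UNIV f ^^ n = f ^^ ((p - 1) * n)"
proof -
  have eq: "f ^^ (p - 1) \<circ> f = id" "f \<circ> f ^^ (p - 1) = id"
    using assms funpow_Suc_right[of "p - 1" f] by (simp_all flip: funpow.simps(2))
  have "inv_into UNIV f = f ^^ (p - 1)"
    by (rule inv_unique_comp) (use eq in auto)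
  then show ?thesis
    by (simp add: funpow_mult)
qed

section \<open>Computing in the quotient algebra \<open>D q\<close>\<close>

lemma D_class_add: "D_class q (x + y) = D_class q x \<oplus>\<^bsub>D q\<^esub> D_class q y"
  and D_class_mult: "D_class q (x * y) = D_class q x \<otimes>\<^bsub>D q\<^esub> D_class q y"
  and D_class_one: "D_class q 1 = \<one>\<^bsub>D q\<^esub>"
  and D_class_carrier: "D_class q x \<in> carrier (D q)"
  using ideal.rcos_ring_hom[OF ideal_rel_ideal, of q]
  unfolding ring_hom_def D_class_def D_def by (auto simp: ring_of_type_algebra_def)

lemma D_class_relation:
  assumes "x - y \<in> relations q"
  shows "D_class q x = D_class q y"
proof -
  let ?R = "ring_of_type_algebra :: 'a free_alg ring"
  interpret ideal "rel_ideal q" ?R by (rule ideal_rel_ideal)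
  have "x - y \<in> rel_ideal q"
    using assms genideal_self[of "relations q"]
    by (auto simp: rel_ideal_def ring_of_type_algebra_def)
  then have "x \<in> rel_ideal q +>\<^bsub>?R\<^esub> y"
    by (auto simp: a_r_coset_def r_coset_def ring_of_type_algebra_def intro!: bexI[of _ "x - y"])
  then show ?thesis
    unfolding D_class_def
    by (intro a_repr_independence[symmetric] a_subgroup) (simp_all add: ring_of_type_algebra_def)
qed

text \<open>Scalars sit at the empty word, hence are central; this is what makes the operators of a
  module linear.\<close>

lemma scal_commute: "scal c * x = x * scal c"
proof (induction x rule: poly_mapping_add_induct)
  case (single k y)
  then show ?case by (simp add: scal_def mult_single mult.commute)
qed (simp_all add: distrib_left distrib_right)

section \<open>Operators on a module and dimensions of weight spaces\<close>

locale D_module =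
  fixes q :: "'k::field" and act :: "'k free_alg set \<Rightarrow> 'v::ab_group_add \<Rightarrow> 'v"
  assumes q: "q \<noteq> 0" and left_module: "left_module (D q) act"
begin

definition op :: "'k free_alg \<Rightarrow> 'v \<Rightarrow> 'v"
  where "op x = act (D_class q x)"

lemma op_add: "op (x + y) v = op x v + op y v"
  and op_mult: "op (x * y) v = op x (op y v)"
  and op_one [simp]: "op 1 v = v"
  and op_add_right: "op x (v + w) = op x v + op x w"
  by (simp_all add: op_def D_class_add D_class_mult D_class_one D_class_carrier
      left_module.act_add_left[OF left_module] left_module.act_add_right[OF left_module]
      left_module.act_mult[OF left_module] left_module.act_one[OF left_module])

lemma op_zero_right [simp]: "op x 0 = 0"
  using op_add_right[of x 0 0] by simp

lemma op_relation: "x - y \<in> relations q \<Longrightarrow> op x = op y"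
  by (simp add: op_def D_class_relation)

abbreviation coef :: "'k laurent \<Rightarrow> 'v \<Rightarrow> 'v"
  where "coef r \<equiv> op (gen (Coef r))"

abbreviation opX :: "'v \<Rightarrow> 'v"
  where "opX \<equiv> op (gen GX)"

abbreviation opY :: "'v \<Rightarrow> 'v"
  where "opY \<equiv> op (gen GY)"

text \<open>The defining relations as operator identities; \<open>Y_coef\<close> is put at
  \<open>alpha q r\<close> so that the inverse automorphism cancels.\<close>

lemma coef_add: "coef (r + s) v = coef r v + coef s v"
  and coef_mult: "coef (r * s) v = coef r (coef s v)"
  and coef_const: "coef (const c) v = op (scal c) v"
  and Y_X: "opY (opX v) = coef tau v"
  and X_Y: "opX (opY v) = coef (alpha q tau) v"
  and X_coef: "opX (coef r v) = coef (alpha q r) (opX v)"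
  and Y_coef: "opY (coef (alpha q r) v) = coef r (opY v)"
  using relations.intros(1,2)[of r s q, THEN op_relation] relations.intros(3)[of c q, THEN op_relation]
    relations.intros(4,5)[of q, THEN op_relation] relations.intros(9)[of r q, THEN op_relation]
    relations.intros(10)[of "alpha q r" q, THEN op_relation] q
  by (auto simp: fun_eq_iff op_add op_mult inv_alpha_alpha)

lemma scale_eq_op: "scale q act c = op (scal c)"
  by (simp add: scale_def op_def)

lemma vector_space_scale: "vector_space (scale q act)"
proof
  fix a b :: 'k and v w :: 'v
  have "scal (a + b) = scal a + scal b" "scal (a * b) = scal a * scal b"
    by (simp_all add: scal_def single_add mult_single)
  moreover have "scal (1 :: 'k) = 1"
    by (simp add: scal_def)
  ultimately show "scale q act a (v + w) = scale q act a v + scale q act a w"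
    "scale q act (a + b) v = scale q act a v + scale q act b v"
    "scale q act a (scale q act b v) = scale q act (a * b) v"
    "scale q act 1 v = v"
    by (simp_all add: scale_eq_op op_add op_add_right op_mult)
qed

sublocale vs: vector_space "scale q act" by (rule vector_space_scale)

lemma linear_op: "Vector_Spaces.linear (scale q act) (scale q act) (op x)"
  unfolding Vector_Spaces.linear_iff
  by (auto simp: vector_space_scale op_add_right scale_eq_op scal_commute simp flip: op_mult)

lemma weight_space_iff: "v \<in> weight_space q act J \<longleftrightarrow> (\<forall>r\<in>J. coef r v = 0)"
  by (simp add: weight_space_def op_def)

lemma subspace_weight_space: "vs.subspace (weight_space q act J)"
proof (rule vs.subspaceI)
  show "scale q act c v \<in> weight_space q act J" if "v \<in> weight_space q act J" for c v
    using that unfolding weight_space_iff scale_eq_op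
    by (metis op_mult op_zero_right scal_commute)
qed (auto simp: weight_space_iff op_add_right)

lemma coef_weight_space:
  assumes "v \<in> weight_space q act J"
  shows "coef s v \<in> weight_space q act J"
  using assms unfolding weight_space_iff by (metis coef_mult mult.commute op_zero_right)

text \<open>Coefficients act on the weight space only through their classes modulo
  \<open>J\<close>.\<close>

lemma coef_eq_id:
  assumes "v \<in> weight_space q act J" "r - 1 \<in> J"
  shows "coef r v = v"
proof -
  have "coef r v = coef ((r - 1) + const 1) v" by simp
  also have "\<dots> = coef (r - 1) v + op (scal 1) v"
    by (simp only: coef_add coef_const)
  also have "\<dots> = v"
    using assms by (simp add: weight_space_iff flip: scale_eq_op)
  finally show ?thesis .
qed

lemma X_image_weight_space:
  assumes s: "s * tau - 1 \<in> J"
  shows "inj_on opX (weight_space q act J)"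
    and "opX ` weight_space q act J = weight_space q act (alpha q ` J)"
proof -
  show "inj_on opX (weight_space q act J)"
    \<comment> \<open>Left inverse of \<open>opX\<close>: \<open>YX\<close> acts as
      \<open>tau\<close>, which \<open>s\<close> inverts modulo \<open>J\<close>.\<close>
    by (rule inj_on_inverseI[of _ "\<lambda>v. coef s (opY v)"])
      (use s coef_eq_id in \<open>simp add: Y_X flip: coef_mult\<close>)
  have "opX v \<in> weight_space q act (alpha q ` J)" if "v \<in> weight_space q act J" for v
    using that by (auto simp: weight_space_iff simp flip: X_coef)
  moreover have "w \<in> opX ` weight_space q act J" if w: "w \<in> weight_space q act (alpha q ` J)" for w
  proof (rule image_eqI)
    have "alpha q (tau * s) - 1 \<in> alpha q ` J"
      using s by (metis alpha_diff_one imageI mult.commute)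
    then show "w = opX (opY (coef (alpha q s) w))"
      using w q coef_eq_id by (simp add: X_Y alpha_mult flip: coef_mult)
    show "opY (coef (alpha q s) w) \<in> weight_space q act J"
      using coef_weight_space[OF w, of "alpha q s"]
      by (simp add: weight_space_iff flip: Y_coef)
  qed
  ultimately show "opX ` weight_space q act J = weight_space q act (alpha q ` J)"
    by blast
qed

lemma dim_weight_space_alpha:
  assumes "s * tau - 1 \<in> J"
  shows "vs.dim (weight_space q act (alpha q ` J)) = vs.dim (weight_space q act J)"
  using vs.dim_image_eq_linear[OF linear_op subspace_weight_space X_image_weight_space(1)[OF assms]]
  by (simp add: X_image_weight_space(2)[OF assms])

lemma dim_weight_space_alpha_funpow:
  assumes "J \<in> Max_R" "tau + const (of_nat n) \<notin> J"
  shows "vs.dim (weight_space q act ((alpha q ^^ Suc n) ` J))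
    = vs.dim (weight_space q act ((alpha q ^^ n) ` J))"
proof -
  obtain s where s: "s * (tau + const (of_nat n)) - 1 \<in> J"
    using assms maximalideal_unit_mod unfolding Max_R_def by blast
  have "(alpha q ^^ n) (f - 1) = (alpha q ^^ n) f - 1" for f
    by (induction n) (simp_all add: alpha_diff_one)
  \<comment> \<open>Transporting the congruence by the \<open>n\<close>-th power replaces
    \<open>tau + const (of_nat n)\<close> by \<open>tau\<close>, as needed at the source of the
    \<open>n\<close>-th arrow.\<close>
  then have "(alpha q ^^ n) s * tau - 1 \<in> (alpha q ^^ n) ` J"
    using imageI[OF s, of "alpha q ^^ n"] q by (simp add: alpha_funpow_mult alpha_funpow_tau_shift)
  from dim_weight_space_alpha[OF this] show ?thesis
    by (simp add: image_comp)
qed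

end

section \<open>Going around the cycle\<close>

lemma periodic_const:
  fixes d :: "nat \<Rightarrow> 'a"
  assumes periodic: "\<And>n. d (n + p) = d n" and "p > 0"
    and step: "\<And>n. \<not> P n \<Longrightarrow> d (Suc n) = d n"
    and exceptional: "\<And>n i. P n \<Longrightarrow> P (n + i) \<Longrightarrow> 0 < i \<Longrightarrow> i < p \<Longrightarrow> False"
  shows "d m = d n"
proof -
  have "d (Suc k) = d k" for k
  proof (cases "P k")
    case True
    \<comment> \<open>An exceptional step at \<open>k\<close> is bypassed the long way round: the
      \<open>p - 1\<close> steps from \<open>Suc k\<close> to \<open>k + p\<close> are ordinary, and
      \<open>d (k + p) = d k\<close>.\<close>
    have "d (k + Suc i) = d (Suc k)" if "i < p" for i
      using that
    proof (induction i)
      case (Suc i)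
      then have "\<not> P (k + Suc i)"
        using exceptional[OF True] by blast
      with Suc step[of "k + Suc i"] show ?case by simp
    qed simp
    from this[of "p - 1"] show ?thesis
      using periodic[of k] \<open>p > 0\<close> by simp
  qed (rule step)
  then have "d k = d 0" for k
    by (induction k) auto
  then show ?thesis by metis
qed

text \<open>The two members would differ by the constant \<open>i\<close>, a unit because
  \<open>i\<close> lies strictly between 0 and the characteristic.\<close>

lemma tau_shift_not_both:
  fixes J :: "'k::field laurent set"
  assumes J: "J \<in> Max_R" and "tau + const (of_nat n) \<in> J" "tau + const (of_nat (n + i)) \<in> J"
    and "0 < i" "i < CHAR('k)"
  shows False
proof -
  have "(of_nat i :: 'k) \<noteq> 0"
    using \<open>0 < i\<close> \<open>i < CHAR('k)\<close> by (auto simp: of_nat_eq_0_iff_char_dvd dest: dvd_imp_le)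
  then have "const (1 / of_nat i) * const (of_nat i) = (1 :: 'k laurent)"
    by (simp flip: const_simps(4))
  then have "const (1 / of_nat i) * ((tau + const (of_nat (n + i))) - (tau + const (of_nat n)))
      = (1 :: 'k laurent)"
    by simp
  then show False
    using J assms(2,3) maximalideal_diff_not_unit unfolding Max_R_def by blast
qed

theorem theorem6:
  fixes q :: "'k::alg_closed_field" and p :: nat
    and act :: "'k free_alg set \<Rightarrow> 'v::ab_group_add \<Rightarrow> 'v"
    and \<omega> :: "'k laurent set set" and \<mm> \<nn> :: "'k laurent set"
  assumes "CHAR('k) = p" and "p > 0"
    and "q \<noteq> 0" and "q ^ p = 1"
    and "\<exists>\<mm>\<^sub>0 \<in> Max_R. \<omega> = alpha_orbit q \<mm>\<^sub>0"
    and "weight_module q act" and "finite_dim q act"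
    and "weight_support q act \<subseteq> \<omega>"
    and "\<mm> \<in> \<omega>" and "\<nn> \<in> \<omega>"
  shows "vector_space.dim (scale q act) (weight_space q act \<mm>)
       = vector_space.dim (scale q act) (weight_space q act \<nn>)"
proof -
  interpret D_module q act
    using assms by (intro D_module.intro) (auto simp: weight_module_def)
  obtain J where J: "J \<in> Max_R" and \<omega>: "\<omega> = alpha_orbit q J"
    using assms by blast
  have period: "alpha q ^^ p = id"
    using assms alpha_funpow_period by blast
  have orbit: "\<exists>n. I = (alpha q ^^ n) ` J" if "I \<in> \<omega>" for I
    using that inv_funpow_eq_funpow[OF period \<open>p > 0\<close>] unfolding \<omega> alpha_orbit_def by auto
  \<comment> \<open>Indexing by exponents instead of ideals avoids counting the elements of the
    orbit.\<close>
  define d where "d n = vs.dim (weight_space q act ((alpha q ^^ n) ` J))" for n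
  have "d m = d n" for m n
  proof (rule periodic_const[where d = d and P = "\<lambda>n. tau + const (of_nat n) \<in> J" and p = p])
    show "d (n + p) = d n" for n
      by (simp add: d_def funpow_add period)
    show "d (Suc n) = d n" if "tau + const (of_nat n) \<notin> J" for n
      unfolding d_def by (rule dim_weight_space_alpha_funpow[OF J that])
    show False
      if "tau + const (of_nat n) \<in> J" "tau + const (of_nat (n + i)) \<in> J" "0 < i" "i < p" for n i
      using that assms(1) tau_shift_not_both[OF J] by blast
  qed (rule \<open>p > 0\<close>)
  then show ?thesis
    using orbit[OF \<open>\<mm> \<in> \<omega>\<close>] orbit[OF \<open>\<nn> \<in> \<omega>\<close>] by (auto simp: d_def)
qed

end
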